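(* Let $n = 2k$, where $k\ge 6$ is an integer. Every closed-twin-free graph of order $n$ with at least $\binom{2k}{2}-(k+1)$ edges has no proper-min-forced vertices.
   Context: All graphs are simple, finite and undirected; the order of a graph is its number of vertices. $N[v]$ is the closed neighbourhood of a vertex $v$. Distinct vertices $u,v$ are closed twins if $N[u]=N[v]$; a graph is closed-twin-free if it has no closed twins. A nonempty set $S\subseteq V(G)$ is called a code; for $v\in V(G)$ let $I(S;v)=S\cap N[v]$. A code $S$ is an identifying code in $G$ if $I(S;v)\neq\emptyset$ for all $v\in V(G)$ and $I(S;u)\neq I(S;v)$ for all distinct $u,v\in V(G)$. A minimum identifying code is an identifying code of the smallest cardinality. In a closed-twin-free graph $G$, a vertex is always-forced if it belongs to every identifying code in $G$; it is min-forced if it belongs to every minimum identifying code in $G$; it is proper-min-forced if it is min-forced but not always-forced. *)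

theory Defs
  imports Main "HOL-Library.Ramsey"
begin

text \<open>
  A graph is given by its vertex set \<open>V\<close> and its set \<open>E\<close> of unordered edges;
  \<open>nsets V 2\<close> is the set of two-element subsets of \<open>V\<close>, so loops and multiple
  edges are excluded.
\<close>

locale simple_graph =
  fixes V :: "'a set" and E :: "'a set set"
  assumes finite_vertices: "finite V"
    and edges_subset: "E \<subseteq> nsets V 2"

definition closed_neighbourhood :: "'a set \<Rightarrow> 'a set set \<Rightarrow> 'a \<Rightarrow> 'a set" where
  "closed_neighbourhood V E v = {u \<in> V. u = v \<or> {u, v} \<in> E}"

definition closed_twins :: "'a set \<Rightarrow> 'a set set \<Rightarrow> 'a \<Rightarrow> 'a \<Rightarrow> bool" where
  "closed_twins V E u v \<longleftrightarrow> u \<in> V \<and> v \<in> V \<and> u \<noteq> v \<and>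
     closed_neighbourhood V E u = closed_neighbourhood V E v"

definition closed_twin_free :: "'a set \<Rightarrow> 'a set set \<Rightarrow> bool" where
  "closed_twin_free V E \<longleftrightarrow> \<not> (\<exists>u v. closed_twins V E u v)"

definition is_code :: "'a set \<Rightarrow> 'a set \<Rightarrow> bool" where
  "is_code V S \<longleftrightarrow> S \<noteq> {} \<and> S \<subseteq> V"

definition I_set :: "'a set \<Rightarrow> 'a set set \<Rightarrow> 'a set \<Rightarrow> 'a \<Rightarrow> 'a set" where
  "I_set V E S v = S \<inter> closed_neighbourhood V E v"

definition identifying_code :: "'a set \<Rightarrow> 'a set set \<Rightarrow> 'a set \<Rightarrow> bool" where
  "identifying_code V E S \<longleftrightarrow> is_code V S \<and>
     (\<forall>v\<in>V. I_set V E S v \<noteq> {}) \<and>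
     (\<forall>u\<in>V. \<forall>v\<in>V. u \<noteq> v \<longrightarrow> I_set V E S u \<noteq> I_set V E S v)"

definition minimum_identifying_code :: "'a set \<Rightarrow> 'a set set \<Rightarrow> 'a set \<Rightarrow> bool" where
  "minimum_identifying_code V E S \<longleftrightarrow> identifying_code V E S \<and>
     (\<forall>T. identifying_code V E T \<longrightarrow> card S \<le> card T)"

text \<open>
  The following notions are meant for closed-twin-free graphs: a graph with
  closed twins has no identifying code, and the quantifiers become vacuous.
\<close>

definition always_forced :: "'a set \<Rightarrow> 'a set set \<Rightarrow> 'a \<Rightarrow> bool" where
  "always_forced V E v \<longleftrightarrow> v \<in> V \<and> (\<forall>S. identifying_code V E S \<longrightarrow> v \<in> S)"

definition min_forced :: "'a set \<Rightarrow> 'a set set \<Rightarrow> 'a \<Rightarrow> bool" where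
  "min_forced V E v \<longleftrightarrow> v \<in> V \<and> (\<forall>S. minimum_identifying_code V E S \<longrightarrow> v \<in> S)"

definition proper_min_forced :: "'a set \<Rightarrow> 'a set set \<Rightarrow> 'a \<Rightarrow> bool" where
  "proper_min_forced V E v \<longleftrightarrow> min_forced V E v \<and> \<not> always_forced V E v"

end

theory Submission
  imports Defs
begin

text \<open>
  Pass to the complement graph: writing \<open>N w\<close> for the set of non-neighbours of \<open>w\<close>, a set \<open>S\<close> is an
  identifying code iff the traces \<open>N w \<inter> S\<close> are pairwise distinct and none of them is all of \<open>S\<close>.
  The complement has at most \<open>k + 1\<close> edges on \<open>2 k\<close> vertices. If a code misses two
  vertices \<open>u\<close>, \<open>v\<close> with \<open>N u\<close>, \<open>N v\<close> nonempty, then the \<open>2 k\<close> distinct traces on the other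
  \<open>2 k - 2\<close> vertices have total size at least \<open>2 k\<close>, which the edge bound allows only if every
  singleton is a trace; some trace has two elements \<open>p\<close>, \<open>q\<close>, and then its owner, \<open>p\<close>
  and \<open>q\<close> all have degree at least \<open>2\<close>, which is one edge end too many. Hence a
  code misses at most one vertex outside the set \<open>Z\<close> of universal vertices, while the vertices
  of \<open>Z\<close> never help to separate. So if some code avoids \<open>v \<notin> Z\<close>, then \<open>V - insert v Z\<close> is a minimum code.
\<close>

section \<open>Degrees in the complement graph\<close>

definition non_neighbours :: "'a set \<Rightarrow> 'a set set \<Rightarrow> 'a \<Rightarrow> 'a set" where
  "non_neighbours V E v = V - closed_neighbourhood V E v"

lemma mem_non_neighbours:
  "x \<in> non_neighbours V E w \<longleftrightarrow> x \<in> V \<and> x \<noteq> w \<and> {x, w} \<notin> E"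
  unfolding non_neighbours_def closed_neighbourhood_def by auto

lemma non_neighbours_subset: "non_neighbours V E w \<subseteq> V"
  unfolding non_neighbours_def by auto

lemma non_neighbours_sym:
  "x \<in> V \<Longrightarrow> w \<in> V \<Longrightarrow> x \<in> non_neighbours V E w \<longleftrightarrow> w \<in> non_neighbours V E x"
  by (auto simp: mem_non_neighbours insert_commute)

lemma finite_non_neighbours: "finite V \<Longrightarrow> finite (non_neighbours V E w)"
  using finite_subset non_neighbours_subset by metis

text \<open>Each complement edge at \<open>w\<close> is matched with its other end. Counting
  incidences in this form serves the degree bound and the double count below.\<close>

lemma card_non_neighbours:
  assumes "w \<in> V"
  shows "card (non_neighbours V E w) = card {e \<in> nsets V 2 - E. w \<in> e}"
proof -
  have "bij_betw (\<lambda>x. {x, w}) (non_neighbours V E w) {e \<in> nsets V 2 - E. w \<in> e}"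
    unfolding bij_betw_def
  proof
    show "inj_on (\<lambda>x. {x, w}) (non_neighbours V E w)"
      by (auto simp: inj_on_def doubleton_eq_iff)
    show "(\<lambda>x. {x, w}) ` non_neighbours V E w = {e \<in> nsets V 2 - E. w \<in> e}"
    proof (intro equalityI subsetI)
      fix e assume "e \<in> (\<lambda>x. {x, w}) ` non_neighbours V E w"
      then show "e \<in> {e \<in> nsets V 2 - E. w \<in> e}"
        using assms by (auto simp: mem_non_neighbours nsets_def)
    next
      fix e assume e: "e \<in> {e \<in> nsets V 2 - E. w \<in> e}"
      then obtain x where "e = {x, w}" "x \<noteq> w" "x \<in> V"
        by (auto simp: nsets_def card_2_iff doubleton_eq_iff)
      then show "e \<in> (\<lambda>x. {x, w}) ` non_neighbours V E w"
        using e by (auto simp: mem_non_neighbours)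
    qed
  qed
  then show ?thesis by (rule bij_betw_same_card)
qed

lemma finite_nsets_Diff: "finite V \<Longrightarrow> finite (nsets V 2 - E)"
  by (simp add: finite_imp_finite_nsets)

lemma card_non_neighbours_le:
  assumes "finite V" "w \<in> V"
  shows "card (non_neighbours V E w) \<le> card (nsets V 2 - E)"
  unfolding card_non_neighbours[OF assms(2)]
  by (rule card_mono) (auto simp: finite_nsets_Diff[OF assms(1)])

text \<open>Handshake lemma for the complement: each of its edges has two ends.\<close>

lemma sum_card_non_neighbours:
  assumes "finite V"
  shows "(\<Sum>w\<in>V. card (non_neighbours V E w)) = 2 * card (nsets V 2 - E)"
proof -
  let ?H = "nsets V 2 - E"
  have "(\<Sum>w\<in>V. card (non_neighbours V E w)) = (\<Sum>w\<in>V. card {e \<in> ?H. w \<in> e})"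
    by (simp add: card_non_neighbours)
  also have "\<dots> = (\<Sum>e\<in>?H. 2)"
  proof (rule sum_multicount_gen)
    show "\<forall>e\<in>?H. card {w \<in> V. w \<in> e} = 2"
    proof
      fix e assume e: "e \<in> ?H"
      then have "{w \<in> V. w \<in> e} = e" by (auto simp: nsets_def)
      then show "card {w \<in> V. w \<in> e} = 2" using e by (simp add: nsets_def)
    qed
  qed (use assms finite_nsets_Diff in auto)
  finally show ?thesis by simp
qed

section \<open>Traces of complement neighbourhoods off two vertices\<close>

text \<open>\<open>N\<close> stands for adjacency in the complement. Distinct traces would force a
  degree sum of at least \<open>card V + 3\<close>, one more than \<open>total\<close>
  permits.\<close>

lemma traces_off_two_vertices_not_inj:
  fixes N :: "'a \<Rightarrow> 'a set"
  assumes fin: "finite V" and sub: "\<And>w. w \<in> V \<Longrightarrow> N w \<subseteq> V"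
    and irrefl: "\<And>w. w \<in> V \<Longrightarrow> w \<notin> N w"
    and sym: "\<And>w x. w \<in> V \<Longrightarrow> x \<in> V \<Longrightarrow> x \<in> N w \<longleftrightarrow> w \<in> N x"
    and total: "(\<Sum>w\<in>V. card (N w)) \<le> card V + 2"
    and uv: "u \<in> V" "v \<in> V" "u \<noteq> v" "N u \<noteq> {}" "N v \<noteq> {}"
  shows "\<not> inj_on (\<lambda>w. N w - {u, v}) V"
proof
  define N' where "N' w = N w - {u, v}" for w
  assume "inj_on (\<lambda>w. N w - {u, v}) V"
  then have inj: "inj_on N' V" unfolding N'_def .
  define W where "W = V - {u, v}"
  have finN: "finite (N w)" if "w \<in> V" for w
    using that sub fin finite_subset by blast
  have finW: "finite W" using fin by (simp add: W_def)
  have cardW: "card W + 2 = card V"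
  proof -
    have "card V = card W + card {u, v}"
      unfolding W_def using fin uv card_Diff_subset[of "{u,v}" V] card_mono[of V "{u,v}"] by simp
    then show ?thesis using uv by simp
  qed
  have deg_pos: "card (N w) \<ge> 1" if "w \<in> V" "x \<in> N w" for w x
    using that finN[of w] by (metis One_nat_def Suc_leI card_gt_0_iff empty_iff)
  \<comment> \<open>Deleting \<open>u\<close> and \<open>v\<close> from all sets \<open>N w\<close>
    loses, by symmetry, one element for each incidence at \<open>u\<close> or
    \<open>v\<close>.\<close>
  have split: "(\<Sum>w\<in>V. card (N w)) = (\<Sum>w\<in>V. card (N' w)) + card (N u) + card (N v)"
  proof -
    have "(\<Sum>w\<in>V. card (N w)) = (\<Sum>w\<in>V. card (N' w) + card (N w \<inter> {u, v}))"
    proof (rule sum.cong)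
      fix w assume "w \<in> V"
      then have "card (N' w \<union> (N w \<inter> {u, v})) = card (N' w) + card (N w \<inter> {u, v})"
        unfolding N'_def using finN[of w] by (intro card_Un_disjoint) auto
      moreover have "N' w \<union> (N w \<inter> {u, v}) = N w" unfolding N'_def by auto
      ultimately show "card (N w) = card (N' w) + card (N w \<inter> {u, v})" by simp
    qed simp
    also have "\<dots> = (\<Sum>w\<in>V. card (N' w)) + (\<Sum>w\<in>V. card (N w \<inter> {u, v}))"
      by (simp add: sum.distrib)
    also have "(\<Sum>w\<in>V. card (N w \<inter> {u, v})) = (\<Sum>w\<in>V. card {x \<in> {u, v}. x \<in> N w})"
      by (intro sum.cong arg_cong[where f = card]) auto
    also have "\<dots> = (\<Sum>x\<in>{u, v}. card (N x))"
    proof (rule sum_multicount_gen)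
      show "\<forall>x\<in>{u, v}. card {w \<in> V. x \<in> N w} = card (N x)"
      proof
        fix x assume "x \<in> {u, v}"
        then have "x \<in> V" using uv by auto
        then have "{w \<in> V. x \<in> N w} = N x" using sym sub by blast
        then show "card {w \<in> V. x \<in> N w} = card (N x)" by simp
      qed
    qed (use fin in auto)
    finally show ?thesis using uv by simp
  qed
  have "card (N u) \<ge> 1" "card (N v) \<ge> 1"
    using deg_pos uv by blast+
  then have upper: "(\<Sum>w\<in>V. card (N' w)) \<le> card V"
    using split total by linarith
  define A where "A = {w \<in> V. N' w = {}}"
  define B where "B = {w \<in> V. card (N' w) = 1}"
  have finAB: "finite A" "finite B" using fin by (auto simp: A_def B_def)
  have cardA: "card A \<le> 1"
    using inj card_le_Suc0_iff_eq[OF finAB(1)] by (simp add: A_def inj_on_def)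
  have imgB: "N' ` B \<subseteq> (\<lambda>x. {x}) ` W"
  proof
    fix X assume "X \<in> N' ` B"
    then obtain w where w: "w \<in> V" "X = N' w" "card X = 1" by (auto simp: B_def)
    then obtain x where "X = {x}" by (auto simp: card_1_singleton_iff)
    moreover have "X \<subseteq> W" using w sub by (auto simp: N'_def W_def)
    ultimately show "X \<in> (\<lambda>x. {x}) ` W" by auto
  qed
  have injB: "card (N' ` B) = card B"
    using inj by (intro card_image inj_on_subset[OF inj]) (auto simp: B_def)
  have cardSing: "card ((\<lambda>x. {x}) ` W) = card W"
    by (intro card_image) auto
  have cardB: "card B \<le> card W"
    using card_mono[OF _ imgB] finW injB cardSing by simp
  \<comment> \<open>An empty trace falls short of size 2 by two and a singleton by one; the
    indicators make up the deficit. With \<open>upper\<close> and \<open>cardA\<close> this leaves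
    at least \<open>card V - 2 = card W\<close> singletons.\<close>
  have "2 * card V \<le> (\<Sum>w\<in>V. card (N' w) + 2 * of_bool (w \<in> A) + of_bool (w \<in> B))"
  proof -
    have "(\<Sum>w\<in>V. 2) \<le> (\<Sum>w\<in>V. card (N' w) + 2 * of_bool (w \<in> A) + of_bool (w \<in> B))"
    proof (rule sum_mono)
      fix w assume w: "w \<in> V"
      have "finite (N' w)" using finN[OF w] by (simp add: N'_def)
      then have "N' w = {} \<or> card (N' w) = 1 \<or> card (N' w) \<ge> 2"
        using card_gt_0_iff[of "N' w"] by linarith
      then show "2 \<le> card (N' w) + 2 * of_bool (w \<in> A) + of_bool (w \<in> B)"
        using w by (auto simp: A_def B_def)
    qed
    then show ?thesis by (simp add: mult.commute)
  qed
  also have "\<dots> = (\<Sum>w\<in>V. card (N' w)) + 2 * card A + card B"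
  proof -
    have "V \<inter> A = A" "V \<inter> B = B" by (auto simp: A_def B_def)
    then show ?thesis
      using fin by (simp add: sum.distrib sum_distrib_left[symmetric] Int_def[symmetric])
  qed
  finally have "card W \<le> card B" using upper cardA cardW by linarith
  then have imgB_eq: "N' ` B = (\<lambda>x. {x}) ` W"
    using finW imgB injB cardSing cardB by (intro card_subset_eq) auto
  \<comment> \<open>At most \<open>1 + (card V - 2)\<close> traces have size below 2, so some
    \<open>w1\<close> has a larger one.\<close>
  have "card (A \<union> B) < card V"
    using cardA cardB cardW card_Un_le[of A B] by linarith
  then obtain w1 where w1: "w1 \<in> V" "w1 \<notin> A" "w1 \<notin> B"
    using card_mono[of "A \<union> B" V] finAB by (meson UnCI finite_UnI leD subsetI)
  have fw1: "finite (N' w1)" using finN[OF w1(1)] by (simp add: N'_def)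
  then have c2: "card (N' w1) \<ge> 2"
    using w1 card_gt_0_iff[of "N' w1"] by (auto simp: A_def B_def intro: Suc_leI le_neq_trans)
  then obtain P where "P \<subseteq> N' w1" "card P = 2"
    by (meson obtain_subset_with_card_n)
  then obtain p q where pq: "p \<in> N' w1" "q \<in> N' w1" "p \<noteq> q"
    by (auto simp: card_2_iff)
  have cover: "\<exists>w\<in>V. N' w = {x}" if "x \<in> W" for x
  proof -
    have "{x} \<in> N' ` B" using imgB_eq that by auto
    then show ?thesis by (auto simp: B_def)
  qed
  \<comment> \<open>A vertex of \<open>W\<close> is adjacent to the owner of its singleton trace;
    for \<open>u\<close> and \<open>v\<close> the degree is positive by hypothesis.\<close>
  have deg1: "card (N x) \<ge> 1" if "x \<in> V" for x
  proof (cases "x \<in> W")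
    case True
    then obtain w where "w \<in> V" "N' w = {x}" using cover by blast
    then have "w \<in> N x" using sym that unfolding N'_def by blast
    then show ?thesis using deg_pos that by blast
  next
    case False
    then show ?thesis using uv that deg_pos by (auto simp: W_def)
  qed
  \<comment> \<open>\<open>x\<close> is adjacent to \<open>w1\<close> and to the owner of the trace
    \<open>{x}\<close>; the two differ because their traces have different sizes.\<close>
  have deg2: "card (N x) \<ge> 2" if x: "x \<in> N' w1" for x
  proof -
    have xW: "x \<in> W" "x \<in> V" using x sub w1 by (auto simp: W_def N'_def)
    then obtain w where w: "w \<in> V" "N' w = {x}" using cover by blast
    have "w \<noteq> w1" using w c2 by auto
    moreover have "{w, w1} \<subseteq> N x" using w x xW sym w1 unfolding N'_def by blast
    ultimately show ?thesis using card_mono[OF finN[OF xW(2)], of "{w, w1}"] by simp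
  qed
  define D where "D = {w1, p, q}"
  have "w1 \<notin> N' w1" using irrefl w1 by (simp add: N'_def)
  then have "w1 \<noteq> p" "w1 \<noteq> q" using pq by metis+
  then have cardD: "card D = 3" using pq(3) by (simp add: D_def)
  have DV: "D \<subseteq> V" using pq w1 sub by (auto simp: D_def N'_def)
  have w1deg: "card (N w1) \<ge> 2"
    using c2 card_mono[OF finN[OF w1(1)], of "N' w1"] by (auto simp: N'_def)
  \<comment> \<open>Degree at least 1 everywhere and at least 2 on the three vertices of
    \<open>D\<close> gives the sum \<open>card V + 3\<close>.\<close>
  have "(\<Sum>w\<in>V. 1 + of_bool (w \<in> D)) \<le> (\<Sum>w\<in>V. card (N w))"
  proof (rule sum_mono)
    fix w assume "w \<in> V"
    then show "1 + of_bool (w \<in> D) \<le> card (N w)"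
      using deg1[of w] deg2[OF pq(1)] deg2[OF pq(2)] w1deg by (cases "w \<in> D") (auto simp: D_def)
  qed
  moreover have "(\<Sum>w\<in>V. 1 + of_bool (w \<in> D)) = card V + card (V \<inter> D)"
    unfolding sum.distrib using fin by (simp add: Int_def)
  moreover have "V \<inter> D = D" using DV by auto
  ultimately show False using total cardD by simp
qed

section \<open>Identifying codes and forced vertices\<close>

text \<open>\<open>I_set V E S w\<close> is the complement within \<open>S\<close> of the trace of
  \<open>w\<close>, so separation carries over and an empty \<open>I_set\<close> means that the
  trace is all of \<open>S\<close>. A vertex of \<open>V\<close> makes the covering condition
  exclude the empty \<open>S\<close>.\<close>

lemma identifying_code_iff:
  assumes "V \<noteq> {}"
  shows "identifying_code V E S \<longleftrightarrow> S \<subseteq> V \<and> (\<forall>w\<in>V. \<not> S \<subseteq> non_neighbours V E w)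
    \<and> inj_on (\<lambda>w. non_neighbours V E w \<inter> S) V"
proof (cases "S \<subseteq> V")
  case True
  then have I: "I_set V E S w = S - non_neighbours V E w" for w
    by (auto simp: I_set_def non_neighbours_def)
  have eq: "S - X = S - Y \<longleftrightarrow> X \<inter> S = Y \<inter> S" for X Y by blast
  show ?thesis
    unfolding identifying_code_def is_code_def I eq inj_on_def using True assms by blast
next
  case False
  then show ?thesis by (simp add: identifying_code_def is_code_def)
qed

lemma minimum_identifying_code_exists:
  assumes "identifying_code V E S"
  shows "\<exists>M. minimum_identifying_code V E M"
  using ex_has_least_nat[of "identifying_code V E" S card] assms
  unfolding minimum_identifying_code_def by blast

lemma no_proper_min_forced:
  assumes fin: "finite V" and twin_free: "closed_twin_free V E"
    and few: "2 * card (nsets V 2 - E) \<le> card V + 2" and large: "card V \<ge> 9"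
  shows "\<not> proper_min_forced V E v"
proof
  let ?N = "non_neighbours V E"
  assume "proper_min_forced V E v"
  then have vV: "v \<in> V" and forced: "\<And>S. minimum_identifying_code V E S \<Longrightarrow> v \<in> S"
    and "\<not> always_forced V E v"
    by (auto simp: proper_min_forced_def min_forced_def)
  then obtain S0 where S0: "identifying_code V E S0" "v \<notin> S0"
    by (auto simp: always_forced_def)
  have code_iff: "identifying_code V E S \<longleftrightarrow> S \<subseteq> V \<and> (\<forall>w\<in>V. \<not> S \<subseteq> ?N w)
    \<and> inj_on (\<lambda>w. ?N w \<inter> S) V" for S
    using vV by (intro identifying_code_iff) auto
  define Z where "Z = {z \<in> V. ?N z = {}}"
  have ZV: "Z \<subseteq> V" by (auto simp: Z_def)
  have finZ: "finite Z" using ZV fin finite_subset by blast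
  have cardZ: "card Z \<le> 1"
  proof -
    have "x = y" if "x \<in> Z" "y \<in> Z" for x y
    proof (rule ccontr)
      assume "x \<noteq> y"
      moreover have "closed_neighbourhood V E x = V" "closed_neighbourhood V E y = V"
        using that by (auto simp: Z_def non_neighbours_def closed_neighbourhood_def)
      ultimately have "closed_twins V E x y"
        using that by (simp add: closed_twins_def Z_def)
      then show False using twin_free by (auto simp: closed_twin_free_def)
    qed
    then show ?thesis using card_le_Suc0_iff_eq[OF finZ] by simp
  qed
  \<comment> \<open>A universal vertex lies in no trace, so deleting \<open>Z\<close> from a code
    changes no trace.\<close>
  have N_Z: "?N w \<inter> Z = {}" if "w \<in> V" for w
    using that non_neighbours_sym[of _ V w E] by (auto simp: Z_def)
  have few_missed: "card (V - S - Z) \<le> 1" if S: "identifying_code V E S" for S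
  proof -
    have "x = y" if "x \<in> V - S - Z" "y \<in> V - S - Z" for x y
    proof (rule ccontr)
      assume "x \<noteq> y"
      then have ninj: "\<not> inj_on (\<lambda>w. ?N w - {x, y}) V"
        using that fin few
        by (intro traces_off_two_vertices_not_inj)
          (auto simp: Z_def sum_card_non_neighbours mem_non_neighbours insert_commute)
      \<comment> \<open>As \<open>S\<close> avoids \<open>x\<close> and \<open>y\<close>, the trace
        on \<open>S\<close> is determined by \<open>?N w - {x, y}\<close>, so injectivity passes to
        the larger traces.\<close>
      have "?N w \<inter> S = (?N w - {x, y}) \<inter> S" for w using that by auto
      then have "inj_on (\<lambda>w. ?N w - {x, y}) V"
        using S unfolding code_iff inj_on_def by metis
      then show False using ninj by simp
    qed
    then show ?thesis using card_le_Suc0_iff_eq[of "V - S - Z"] fin by simp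
  qed
  have card_code: "card V \<le> card (S - Z) + card Z + 1" if S: "identifying_code V E S" for S
  proof -
    have "V = (S - Z) \<union> (Z \<union> (V - S - Z))" using S ZV by (auto simp: code_iff)
    then have "card V \<le> card (S - Z) + (card Z + card (V - S - Z))"
      by (metis (no_types, lifting) add_left_mono card_Un_le le_trans)
    then show ?thesis using few_missed[OF S] by linarith
  qed
  \<comment> \<open>Otherwise \<open>w\<close> meets at least \<open>card V - 2\<close> complement
    edges; as twice their number is at most \<open>card V + 2\<close>, this gives
    \<open>card V\<close> \<le> 6, against \<open>large\<close>.\<close>
  have not_trace: "\<not> T \<subseteq> ?N w" if "card V \<le> card T + 2" "w \<in> V" for T w
  proof
    assume "T \<subseteq> ?N w"
    then have "card T \<le> card (?N w)"
      using finite_non_neighbours[OF fin] by (rule card_mono[rotated])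
    then have "card T \<le> card (nsets V 2 - E)"
      using card_non_neighbours_le[OF fin that(2), of E] by linarith
    then show False using that few large by linarith
  qed
  \<comment> \<open>\<open>card_code\<close> and \<open>cardZ\<close> show that \<open>S - Z\<close>
    misses at most two vertices, so \<open>not_trace\<close> keeps every vertex covered.\<close>
  have diff_Z: "identifying_code V E (S - Z)" if S: "identifying_code V E S" for S
  proof -
    have "inj_on (\<lambda>w. ?N w \<inter> S) V" "S \<subseteq> V" using S by (auto simp: code_iff)
    moreover have "?N w \<inter> (S - Z) = ?N w \<inter> S" if "w \<in> V" for w using N_Z[OF that] by auto
    ultimately show ?thesis
      using not_trace card_code[OF S] cardZ unfolding code_iff inj_on_def by auto
  qed
  show False
  proof (cases "v \<in> Z")
    \<comment> \<open>Deleting \<open>Z\<close> from a minimum code leaves a minimum code avoiding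
      \<open>v\<close>.\<close>
    case True
    obtain M where M: "minimum_identifying_code V E M"
      using minimum_identifying_code_exists[OF S0(1)] by blast
    then have "finite M" using fin finite_subset
      by (auto simp: minimum_identifying_code_def code_iff)
    then have "card (M - Z) \<le> card M" by (intro card_mono) auto
    then have "minimum_identifying_code V E (M - Z)"
      using M diff_Z unfolding minimum_identifying_code_def by (meson le_trans)
    then show False using forced True by blast
  next
    case False
    let ?T = "V - {v} - Z"
    \<comment> \<open>Both code conditions pass from \<open>S0\<close> to the superset
      \<open>V - {v}\<close>, from which \<open>Z\<close> can then be deleted.\<close>
    have sub: "S0 \<subseteq> V - {v}" using S0 by (auto simp: code_iff)
    have "?N w \<inter> S0 = (?N w \<inter> (V - {v})) \<inter> S0" for w using sub by auto
    then have "inj_on (\<lambda>w. ?N w \<inter> (V - {v})) V"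
      using S0(1) unfolding code_iff inj_on_def by metis
    moreover have "\<forall>w\<in>V. \<not> V - {v} \<subseteq> ?N w"
      using S0(1) sub unfolding code_iff by blast
    ultimately have "identifying_code V E (V - {v})" by (auto simp: code_iff)
    then have T: "identifying_code V E ?T" by (rule diff_Z)
    \<comment> \<open>This size is exactly the lower bound that \<open>card_code\<close> gives for
      every code.\<close>
    have "card ?T = card V - 1 - card Z"
      using False vV ZV fin finZ by (subst card_Diff_subset) auto
    moreover have "card (S - Z) \<le> card S" if "identifying_code V E S" for S
      using that fin finite_subset by (intro card_mono) (auto simp: code_iff)
    ultimately have "card ?T \<le> card S" if "identifying_code V E S" for S
      using that card_code[OF that] by fastforce
    then have "minimum_identifying_code V E ?T"
      using T by (simp add: minimum_identifying_code_def)
    then show False using forced by blast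
  qed
qed

theorem theorem16:
  fixes k n :: nat and V :: "'a set" and E :: "'a set set"
  assumes "k \<ge> 6" and "n = 2 * k"
    and "simple_graph V E" and "closed_twin_free V E"
    and "card V = n"
    and "card E \<ge> (2 * k choose 2) - (k + 1)"
  shows "\<not> (\<exists>v. proper_min_forced V E v)"
proof -
  have fin: "finite V" and EV: "E \<subseteq> nsets V 2"
    using assms(3) by (simp_all add: simple_graph_def)
  have "card (nsets V 2 - E) = card (nsets V 2) - card E"
    using fin EV finite_imp_finite_nsets finite_subset by (metis card_Diff_subset)
  then have "card (nsets V 2 - E) \<le> k + 1"
    using assms by simp
  \<comment> \<open>Twice \<open>k + 1\<close> is \<open>card V + 2\<close>, and \<open>k\<close>
    \<ge> 6 gives at least 12 vertices.\<close>
  then show ?thesis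
    using no_proper_min_forced[OF fin assms(4)] assms by simp
qed

end
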